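(* There is an algorithm which, for every $3$-dimensional grid $G$, returns a $(3,2)$-partition of $G$ in time polynomial in $|V(G)|$. In particular, every $3$-dimensional grid has a $(3,2)$-partition.
   Context: A $3$-dimensional grid is a Cartesian product $P_{n_1}\square P_{n_2}\square P_{n_3}$ of three paths, each on at least two vertices; here $G_1\square G_2$ has vertex set $V(G_1)\times V(G_2)$, with $(x_1,y_1)(x_2,y_2)$ an edge iff either $x_1=x_2$ and $y_1y_2\in E(G_2)$, or $y_1=y_2$ and $x_1x_2\in E(G_1)$. For $k,d\in\mathbb{N}$, a $(k,d)$-partition of a graph $G$ is a partition $S_1\cup\cdots\cup S_{\eta+1}$ of $V(G)$ such that $|S_1|\le k$, $|S_j|=k$ for $j\in\{2,\dots,\eta+1\}$, and for each $j\in\{2,\dots,\eta+1\}$ there is an ordering $x_1^j,\dots,x_k^j$ of $S_j$ with $|N_G(x_i^j)\cap(S_1\cup\cdots\cup S_{j-1})|\le di-1$ for every $i\in\{1,\dots,k\}$, where $N_G(v)$ is the set of neighbours of $v$. *)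

theory Defs
  imports "HOL-Library.Disjoint_Sets" "HOL-Computational_Algebra.Polynomial"
begin

section \<open>Graphs and grids\<close>

record 'a graph =
  verts :: "'a set"
  adj :: "'a \<Rightarrow> 'a \<Rightarrow> bool"

definition simple_graph :: "'a graph \<Rightarrow> bool" where
  "simple_graph G \<longleftrightarrow> finite (verts G) \<and>
     (\<forall>u v. adj G u v \<longrightarrow> u \<in> verts G \<and> v \<in> verts G \<and> u \<noteq> v \<and> adj G v u)"

definition neighbours :: "'a graph \<Rightarrow> 'a \<Rightarrow> 'a set" where
  "neighbours G v = {u \<in> verts G. adj G v u}"

definition isomorphic :: "'a graph \<Rightarrow> 'b graph \<Rightarrow> bool" where
  "isomorphic G H \<longleftrightarrow> (\<exists>f. bij_betw f (verts G) (verts H) \<and>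
     (\<forall>u\<in>verts G. \<forall>v\<in>verts G. adj G u v \<longleftrightarrow> adj H (f u) (f v)))"

definition path_graph :: "nat \<Rightarrow> nat graph" where
  "path_graph n = \<lparr>verts = {..<n},
     adj = (\<lambda>i j. i < n \<and> j < n \<and> (j = Suc i \<or> i = Suc j))\<rparr>"

definition cart_prod :: "'a graph \<Rightarrow> 'b graph \<Rightarrow> ('a \<times> 'b) graph" (infixl "\<box>" 70) where
  "G \<box> H = \<lparr>verts = verts G \<times> verts H,
     adj = (\<lambda>(x1, y1) (x2, y2).
        x1 = x2 \<and> x1 \<in> verts G \<and> adj H y1 y2 \<or> y1 = y2 \<and> y1 \<in> verts H \<and> adj G x1 x2)\<rparr>"

text \<open>Paths, and hence grids, are understood up to isomorphism: the vertices may carry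
  arbitrary names.\<close>

definition grid3d :: "'a graph \<Rightarrow> bool" where
  "grid3d G \<longleftrightarrow> simple_graph G \<and>
     (\<exists>n1 n2 n3. n1 \<ge> 2 \<and> n2 \<ge> 2 \<and> n3 \<ge> 2 \<and>
        isomorphic G (path_graph n1 \<box> path_graph n2 \<box> path_graph n3))"

section \<open>$(k,d)$-partitions\<close>

text \<open>The blocks $S_1, \dots, S_{\eta+1}$ form a list indexed from 0, so \<open>S ! j\<close> is
  $S_{j+1}$ and $S_1 \cup \dots \cup S_j$ is \<open>\<Union>l<j. S ! l\<close>. The bound $di-1$ is taken in the
  integers, as subtraction on \<open>nat\<close> truncates.\<close>

definition kd_partition :: "nat \<Rightarrow> nat \<Rightarrow> 'a graph \<Rightarrow> 'a set list \<Rightarrow> bool" where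
  "kd_partition k d G S \<longleftrightarrow>
     S \<noteq> [] \<and> distinct S \<and> partition_on (verts G) (set S) \<and>
     finite (S ! 0) \<and> card (S ! 0) \<le> k \<and>
     (\<forall>j\<in>{1..<length S}. card (S ! j) = k \<and>
        (\<exists>xs. distinct xs \<and> set xs = S ! j \<and>
           (\<forall>i\<in>{1..k}. int (card (neighbours G (xs ! (i - 1)) \<inter> (\<Union>l<j. S ! l)))
                          \<le> int d * int i - 1)))"

section \<open>Algorithms and running time\<close>

text \<open>
  Algorithms are programs of a random-access machine with structured control flow. A program
  works on finitely many named unbounded arrays of natural numbers; a scalar is cell 0 of an
  array. Every elementary operation costs one time unit. Since the only arithmetic operations
  are addition and truncated subtraction, one step lengthens the largest number by at most a
  constant number of bits (depending on the program), and so polynomial time in this unit-cost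
  model agrees with polynomial time on Turing machines.\<close>

type_synonym vname = string
type_synonym state = "vname \<Rightarrow> nat \<Rightarrow> nat"

datatype aexp = Const nat | Read vname aexp | Add aexp aexp | Sub aexp aexp

datatype bexp = Less aexp aexp | Equal aexp aexp | Neg bexp | Conj bexp bexp

datatype com =
    Skip
  | Write vname aexp aexp
  | Seq com com
  | Cond bexp com com
  | While bexp com

fun aval :: "aexp \<Rightarrow> state \<Rightarrow> nat" where
  "aval (Const n) s = n"
| "aval (Read x a) s = s x (aval a s)"
| "aval (Add a b) s = aval a s + aval b s"
| "aval (Sub a b) s = aval a s - aval b s"

fun acost :: "aexp \<Rightarrow> nat" where
  "acost (Const n) = 1"
| "acost (Read x a) = 1 + acost a"
| "acost (Add a b) = 1 + acost a + acost b"
| "acost (Sub a b) = 1 + acost a + acost b"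

fun bval :: "bexp \<Rightarrow> state \<Rightarrow> bool" where
  "bval (Less a b) s \<longleftrightarrow> aval a s < aval b s"
| "bval (Equal a b) s \<longleftrightarrow> aval a s = aval b s"
| "bval (Neg b) s \<longleftrightarrow> \<not> bval b s"
| "bval (Conj b c) s \<longleftrightarrow> bval b s \<and> bval c s"

fun bcost :: "bexp \<Rightarrow> nat" where
  "bcost (Less a b) = 1 + acost a + acost b"
| "bcost (Equal a b) = 1 + acost a + acost b"
| "bcost (Neg b) = 1 + bcost b"
| "bcost (Conj b c) = 1 + bcost b + bcost c"

text \<open>\<open>exec c s t s'\<close>: program \<open>c\<close>, started in state \<open>s\<close>, halts in state \<open>s'\<close> after exactly
  \<open>t\<close> time units. \<open>Write x a b\<close> is the assignment \<open>x[a] := b\<close>.\<close>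

inductive exec :: "com \<Rightarrow> state \<Rightarrow> nat \<Rightarrow> state \<Rightarrow> bool" where
  Skip: "exec Skip s 1 s"
| Write: "exec (Write x a b) s (1 + acost a + acost b) (s(x := (s x)(aval a s := aval b s)))"
| Seq: "exec c1 s t1 s1 \<Longrightarrow> exec c2 s1 t2 s2 \<Longrightarrow> exec (Seq c1 c2) s (t1 + t2) s2"
| CondTrue: "bval b s \<Longrightarrow> exec c1 s t s1 \<Longrightarrow> exec (Cond b c1 c2) s (1 + bcost b + t) s1"
| CondFalse: "\<not> bval b s \<Longrightarrow> exec c2 s t s1 \<Longrightarrow> exec (Cond b c1 c2) s (1 + bcost b + t) s1"
| WhileFalse: "\<not> bval b s \<Longrightarrow> exec (While b c) s (1 + bcost b) s"
| WhileTrue: "bval b s \<Longrightarrow> exec c s t1 s1 \<Longrightarrow> exec (While b c) s1 t2 s2 \<Longrightarrow>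
    exec (While b c) s (1 + bcost b + t1 + t2) s2"

inductive_cases exec_elims:
  "exec Skip s t s'" "exec (Write x a b) s t s'" "exec (Seq c1 c2) s t s'"
  "exec (Cond b c1 c2) s t s'"
inductive_cases exec_WhileE: "exec (While b c) s t s'"

text \<open>Hence the halting run of a program on a given input is unique.\<close>

lemma exec_deterministic:
  "exec c s t s' \<Longrightarrow> exec c s u s'' \<Longrightarrow> t = u \<and> s' = s''"
proof (induction arbitrary: u s'' rule: exec.induct)
  case (Skip s)
  then show ?case by (rule exec_elims(1)) simp
next
  case (Write x a b s)
  then show ?case by (rule exec_elims(2)) simp
next
  case (Seq c1 s t1 s1 c2 t2 s2)
  from Seq.prems obtain u1 r u2
    where *: "u = u1 + u2" "exec c1 s u1 r" "exec c2 r u2 s''"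
    by (rule exec_elims(3))
  with Seq.IH(1)[OF *(2)] Seq.IH(2)[of u2 s''] show ?case by simp
next
  case (CondTrue b s c1 t s1 c2)
  from CondTrue.prems CondTrue.hyps(1) obtain u1
    where *: "u = Suc (bcost b + u1)" "exec c1 s u1 s''"
    by (auto elim: exec_elims(4))
  with CondTrue.IH[OF *(2)] show ?case by simp
next
  case (CondFalse b s c2 t s1 c1)
  from CondFalse.prems CondFalse.hyps(1) obtain u1
    where *: "u = Suc (bcost b + u1)" "exec c2 s u1 s''"
    by (auto elim: exec_elims(4))
  with CondFalse.IH[OF *(2)] show ?case by simp
next
  case (WhileFalse b s c)
  from WhileFalse.prems show ?case
    by (rule exec_WhileE) (simp_all add: WhileFalse.hyps)
next
  case (WhileTrue b s c t1 s1 t2 s2)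
  from WhileTrue.prems show ?case
  proof (rule exec_WhileE)
    fix u1 r u2
    assume *: "u = Suc (bcost b + u1 + u2)" "exec c s u1 r" "exec (While b c) r u2 s''"
    with WhileTrue.IH(1)[OF *(2)] WhileTrue.IH(2)[of u2 s''] show ?case by simp
  qed (simp add: WhileTrue.hyps(1))
qed

text \<open>A graph on $\{0, \dots, n-1\}$ is given to a program by \<open>n\<close> and its adjacency matrix, stored
  row by row; all other cells are 0. The program returns the number of blocks and, for each
  vertex, the number of its block, counted from 1.\<close>

definition graph_input :: "nat graph \<Rightarrow> state" where
  "graph_input G = (let n = card (verts G) in
     (\<lambda>x i. if x = ''n'' \<and> i = 0 then n
            else if x = ''adj'' \<and> i < n * n \<and> adj G (i div n) (i mod n) then 1
            else 0))"

definition blocks_output :: "nat \<Rightarrow> state \<Rightarrow> nat set list" where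
  "blocks_output n s = map (\<lambda>j. {v. v < n \<and> s ''block'' v = j}) [1..<Suc (s ''blocks'' 0)]"

end

theory Submission
  imports Defs
begin

text \<open>
  Blocks are split off one at a time from the end: a set \<open>H\<close> of at least three grid vertices always
  contains \<open>a, b, c\<close> with at most 1, 3, 5 neighbours in \<open>H - {a, b, c}\<close>. Let \<open>v\<close> be the
  lexicographically least vertex of \<open>H\<close>; its neighbours in \<open>H\<close> are among \<open>v + e\<^sub>1, v + e\<^sub>2, v + e\<^sub>3\<close>.
  If all three occur, then \<open>w = v + e\<^sub>3\<close> has at most four neighbours in \<open>H\<close>, because \<open>w - e\<^sub>1\<close> and
  \<open>w - e\<^sub>2\<close> precede \<open>v\<close>, and \<open>v\<close>, \<open>w\<close> and a further neighbour of \<open>v\<close> will do. If at most two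
  occur, take \<open>v\<close>, the least vertex of the rest, and a neighbour of \<open>v\<close> (or the least vertex of
  \<open>H - {v}\<close> if \<open>v\<close> has none). As \<open>H\<close> is arbitrary, any choice of a triple can be continued, and the algorithm never has to recover coordinates:
  it searches all triples exhaustively for each block.\<close>

section \<open>Removable triples\<close>

text \<open>The bounds 1, 3, 5 are \<open>2 * i - 1\<close> for i = 1, 2, 3, so
  \<open>a, b, c\<close> is the ordering that a block requires. \<open>H\<close> stands for the
  block together with all earlier ones.\<close>

definition removable :: "'a graph \<Rightarrow> 'a set \<Rightarrow> 'a \<Rightarrow> 'a \<Rightarrow> 'a \<Rightarrow> bool" where
  "removable G H a b c \<longleftrightarrow> a \<in> H \<and> b \<in> H \<and> c \<in> H \<and> a \<noteq> b \<and> a \<noteq> c \<and> b \<noteq> c \<and>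
     card (neighbours G a \<inter> (H - {a, b, c})) \<le> 1 \<and>
     card (neighbours G b \<inter> (H - {a, b, c})) \<le> 3 \<and>
     card (neighbours G c \<inter> (H - {a, b, c})) \<le> 5"

text \<open>Adjacency in the unbounded grid on triples of naturals. The side lengths are forgotten,
  as the coordinates only serve to bound degrees from above.\<close>

definition unit_step :: "nat \<times> nat \<times> nat \<Rightarrow> nat \<times> nat \<times> nat \<Rightarrow> bool" where
  "unit_step = (\<lambda>(x, y, z) (x', y', z').
     x' = Suc x \<and> y' = y \<and> z' = z \<or> x = Suc x' \<and> y' = y \<and> z' = z \<or>
     x' = x \<and> y' = Suc y \<and> z' = z \<or> x' = x \<and> y = Suc y' \<and> z' = z \<or>
     x' = x \<and> y' = y \<and> z' = Suc z \<or> x' = x \<and> y' = y \<and> z = Suc z')"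

section \<open>Coordinates and degrees in a grid\<close>

lemma grid3d_coordinates:
  assumes "grid3d G"
  obtains \<phi> where "inj_on \<phi> (verts G)" "\<And>u v. adj G u v \<Longrightarrow> unit_step (\<phi> u) (\<phi> v)"
proof -
  from assms obtain n1 n2 n3 f where sg: "simple_graph G"
    and f: "bij_betw f (verts G) (verts (path_graph n1 \<box> path_graph n2 \<box> path_graph n3))"
    and adj: "\<forall>u\<in>verts G. \<forall>v\<in>verts G. adj G u v \<longleftrightarrow>
      adj (path_graph n1 \<box> path_graph n2 \<box> path_graph n3) (f u) (f v)"
    unfolding grid3d_def isomorphic_def by blast
  \<comment> \<open>The product associates to the left, so its vertices have the form
    \<open>((x, y), z)\<close>.\<close>
  let ?h = "\<lambda>((x, y), z). (x, y, z)"
  have "inj_on (?h \<circ> f) (verts G)"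
    using f by (intro comp_inj_on) (auto simp: bij_betw_def inj_on_def)
  moreover have "unit_step ((?h \<circ> f) u) ((?h \<circ> f) v)" if "adj G u v" for u v
  proof -
    have "u \<in> verts G" "v \<in> verts G"
      using that sg by (auto simp: simple_graph_def)
    then have "adj (path_graph n1 \<box> path_graph n2 \<box> path_graph n3) (f u) (f v)"
      using adj that by blast
    then show ?thesis
      by (cases "f u"; cases "f v")
        (auto simp: cart_prod_def path_graph_def unit_step_def split: prod.splits)
  qed
  ultimately show ?thesis by (rule that)
qed

lemma grid3d_nonempty:
  assumes "grid3d G"
  shows "verts G \<noteq> {}"
proof -
  from assms obtain n1 n2 n3 f where n: "n1 \<ge> 2" "n2 \<ge> 2" "n3 \<ge> 2"
    and f: "bij_betw f (verts G) (verts (path_graph n1 \<box> path_graph n2 \<box> path_graph n3))"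
    unfolding grid3d_def isomorphic_def by blast
  have "((0, 0), 0) \<in> verts (path_graph n1 \<box> path_graph n2 \<box> path_graph n3)"
    using n by (simp add: cart_prod_def path_graph_def)
  then show "verts G \<noteq> {}"
    using f by (auto simp: bij_betw_def)
qed

lemma card_le_if_coordinates:
  assumes "inj_on \<phi> A" "\<phi> ` A \<subseteq> set xs"
  shows "card A \<le> length xs"
proof -
  have "card A = card (\<phi> ` A)"
    using assms(1) by (simp add: card_image)
  also have "\<dots> \<le> card (set xs)"
    using assms(2) by (intro card_mono) auto
  also have "\<dots> \<le> length xs"
    by (rule card_length)
  finally show ?thesis .
qed

lemma grid3d_degree_le:
  assumes "grid3d G"
  shows "card (neighbours G v) \<le> 6"
proof -
  from assms obtain \<phi> where \<phi>: "inj_on \<phi> (verts G)"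
    and step: "\<And>u v. adj G u v \<Longrightarrow> unit_step (\<phi> u) (\<phi> v)"
    using grid3d_coordinates by blast
  obtain x y z where v: "\<phi> v = (x, y, z)" by (cases "\<phi> v")
  \<comment> \<open>If a coordinate is 0, truncated subtraction only puts a spurious point on the
    list, which does no harm to an upper bound.\<close>
  have "card (neighbours G v) \<le> length [(x+1,y,z), (x-1,y,z), (x,y+1,z), (x,y-1,z), (x,y,z+1), (x,y,z-1)]"
  proof (rule card_le_if_coordinates[of \<phi>])
    show "inj_on \<phi> (neighbours G v)"
      using \<phi> by (rule inj_on_subset) (auto simp: neighbours_def)
    show "\<phi> ` neighbours G v \<subseteq> set [(x+1,y,z), (x-1,y,z), (x,y+1,z), (x,y-1,z), (x,y,z+1), (x,y,z-1)]"
      using step[of v] by (force simp: neighbours_def unit_step_def v)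
  qed
  then show ?thesis by simp
qed

section \<open>Vertices of low degree in arbitrary subsets of a grid\<close>

lemma low_degree_vertex:
  assumes "grid3d G" "H \<subseteq> verts G" "H \<noteq> {}"
  obtains v where "v \<in> H" "card (neighbours G v \<inter> H) \<le> 3"
    "card (neighbours G v \<inter> H) = 3 \<Longrightarrow>
       \<exists>w \<in> neighbours G v \<inter> H. card (neighbours G w \<inter> H) \<le> 4"
proof -
  from assms(1) obtain \<phi> where \<phi>: "inj_on \<phi> (verts G)"
    and step: "\<And>u v. adj G u v \<Longrightarrow> unit_step (\<phi> u) (\<phi> v)"
    using grid3d_coordinates by blast
  have inj: "inj_on \<phi> (A \<inter> H)" for A
    using \<phi> assms(2) by (auto intro: inj_on_subset)
  let ?R = "less_than <*lex*> less_than <*lex*> less_than"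
  have "wf (inv_image ?R \<phi>)"
    by (intro wf_inv_image wf_lex_prod wf_less_than)
  then obtain v where v: "v \<in> H" and least: "\<And>w. (\<phi> w, \<phi> v) \<in> ?R \<Longrightarrow> w \<notin> H"
    using assms(3) by (metis wfE_min' in_inv_image)
  obtain x y z where xyz: "\<phi> v = (x, y, z)" by (cases "\<phi> v")
  \<comment> \<open>Hence a neighbour obtained by lowering a coordinate of \<open>v\<close> lies
    outside \<open>H\<close>.\<close>
  have least': "\<not> (x' < x \<or> x' = x \<and> (y' < y \<or> y' = y \<and> z' < z))"
    if "\<phi> w = (x', y', z')" "w \<in> H" for w x' y' z'
    using least[of w] that by (auto simp: xyz)
  have sub: "\<phi> ` (neighbours G v \<inter> H) \<subseteq> {(x+1,y,z), (x,y+1,z), (x,y,z+1)}"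
  proof (rule image_subsetI)
    fix w assume "w \<in> neighbours G v \<inter> H"
    then show "\<phi> w \<in> {(x+1,y,z), (x,y+1,z), (x,y,z+1)}"
      using step[of v w] least'[of w]
      by (cases "\<phi> w") (auto simp: neighbours_def unit_step_def xyz)
  qed
  have le3: "card (neighbours G v \<inter> H) \<le> 3"
    using card_le_if_coordinates[OF inj, of _ "[(x+1,y,z), (x,y+1,z), (x,y,z+1)]"] sub
    by (simp add: numeral_eq_Suc)
  have "\<exists>w \<in> neighbours G v \<inter> H. card (neighbours G w \<inter> H) \<le> 4"
    if 3: "card (neighbours G v \<inter> H) = 3"
  proof -
    \<comment> \<open>Three neighbours in three possible places fill them all, in particular the one
      above \<open>v\<close> in the last coordinate.\<close>
    have "\<phi> ` (neighbours G v \<inter> H) = {(x+1,y,z), (x,y+1,z), (x,y,z+1)}"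
    proof (rule card_subset_eq[OF _ sub])
      show "card (\<phi> ` (neighbours G v \<inter> H)) = card {(x+1,y,z), (x,y+1,z), (x,y,z+1)}"
        using 3 by (simp add: card_image[OF inj])
    qed simp
    then have "(x, y, z+1) \<in> \<phi> ` (neighbours G v \<inter> H)"
      by simp
    then obtain w where w: "w \<in> neighbours G v \<inter> H" "\<phi> w = (x, y, z+1)"
      by (elim imageE) simp
    have "\<phi> ` (neighbours G w \<inter> H) \<subseteq> {(x+1,y,z+1), (x,y+1,z+1), (x,y,z+2), (x,y,z)}"
    proof (rule image_subsetI)
      fix u assume "u \<in> neighbours G w \<inter> H"
      then show "\<phi> u \<in> {(x+1,y,z+1), (x,y+1,z+1), (x,y,z+2), (x,y,z)}"
        using step[of w u] least'[of u]
        by (cases "\<phi> u") (auto simp: neighbours_def unit_step_def w(2))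
    qed
    then have "card (neighbours G w \<inter> H) \<le> 4"
      using card_le_if_coordinates[OF inj, of _ "[(x+1,y,z+1), (x,y+1,z+1), (x,y,z+2), (x,y,z)]"]
      by (simp add: numeral_eq_Suc)
    with w show ?thesis by blast
  qed
  with v le3 show ?thesis by (rule that)
qed

lemma removable_exists:
  assumes G: "grid3d G" and H: "H \<subseteq> verts G" and card: "3 \<le> card H"
  obtains a b c where "removable G H a b c"
proof -
  have fin: "finite H"
    using card by (metis card.infinite not_numeral_le_zero)
  have sym: "v \<in> neighbours G u" if "u \<in> neighbours G v" for u v
    using G that by (auto simp: grid3d_def simple_graph_def neighbours_def)
  have irr: "v \<notin> neighbours G v" for v
    using G by (auto simp: grid3d_def simple_graph_def neighbours_def)
  have finN: "finite (neighbours G v)" for v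
    using G by (auto simp: grid3d_def simple_graph_def neighbours_def)
  \<comment> \<open>\<open>u\<close> and \<open>w\<close> may coincide. Some vertex of
    \<open>H\<close> is left in any case, and the low-degree lemma applies to
    \<open>H - {u, w}\<close>.\<close>
  have ex: "\<exists>x \<in> H - {u, w}. card (neighbours G x \<inter> (H - {u, w})) \<le> 3" for u w
  proof -
    have "card {u, w} \<le> 2"
      by (simp add: card_insert_if)
    then have "\<not> H \<subseteq> {u, w}"
      using card card_mono[of "{u, w}" H] by auto
    then have "H - {u, w} \<noteq> {}" by blast
    then show ?thesis
      using low_degree_vertex[OF G, of "H - {u, w}"] H by (metis Diff_subset subset_trans)
  qed
  \<comment> \<open>One of the at most six neighbours of \<open>x\<close> is \<open>v\<close>, which
    is removed together with it. So a neighbour of \<open>v\<close> can always take the third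
    place.\<close>
  have le5: "card (neighbours G x \<inter> (H - {v, w, x})) \<le> 5" if "x \<in> neighbours G v" for v w x
  proof -
    have "card (neighbours G x \<inter> (H - {v, w, x})) \<le> card (neighbours G x - {v})"
      using finN by (intro card_mono) auto
    also have "\<dots> \<le> 5"
      using grid3d_degree_le[OF G, of x] sym[OF that] finN by (simp add: card_Diff_singleton)
    finally show ?thesis .
  qed
  have "H \<noteq> {}" using card by auto
  then obtain v where v: "v \<in> H" and le3: "card (neighbours G v \<inter> H) \<le> 3"
    and w: "card (neighbours G v \<inter> H) = 3 \<Longrightarrow>
      \<exists>w \<in> neighbours G v \<inter> H. card (neighbours G w \<inter> H) \<le> 4"
    using low_degree_vertex[OF G H] by blast
  \<comment> \<open>Three neighbours need the refined choice of \<open>w\<close>; with one or two,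
    removing a single neighbour leaves \<open>v\<close> at most one.\<close>
  consider (three) "card (neighbours G v \<inter> H) = 3"
    | (few) x where "card (neighbours G v \<inter> H) \<le> 2" "x \<in> neighbours G v \<inter> H"
    | (isolated) "neighbours G v \<inter> H = {}"
    using le3 by fastforce
  then show ?thesis
  proof cases
    case three
    then obtain w where w: "w \<in> neighbours G v \<inter> H" "card (neighbours G w \<inter> H) \<le> 4"
      using w by blast
    have "card (neighbours G v \<inter> H - {w}) = 2"
      using three w finN by (simp add: card_Diff_singleton)
    then obtain x where x: "x \<in> neighbours G v \<inter> H - {w}"
      by (metis card.empty ex_in_conv zero_neq_numeral)
    have "card (neighbours G v \<inter> (H - {v, w, x})) \<le> card (neighbours G v \<inter> H - {w} - {x})"
      using finN by (intro card_mono) auto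
    also have "\<dots> = 1"
      using three w x finN by (simp add: card_Diff_singleton)
    finally have 1: "card (neighbours G v \<inter> (H - {v, w, x})) \<le> 1" .
    have "card (neighbours G w \<inter> (H - {v, w, x})) \<le> card (neighbours G w \<inter> H - {v})"
      using finN by (intro card_mono) auto
    also have "\<dots> \<le> 3"
      using w v sym[of w v] finN by (simp add: card_Diff_singleton)
    finally have 2: "card (neighbours G w \<inter> (H - {v, w, x})) \<le> 3" .
    have "removable G H v w x"
      unfolding removable_def using 1 2 le5[of x v w] v w x irr by auto
    then show ?thesis by (rule that)
  next
    case few
    obtain b where b: "b \<in> H - {v, x}" "card (neighbours G b \<inter> (H - {v, x})) \<le> 3"
      using ex by blast
    have "card (neighbours G v \<inter> (H - {v, b, x})) \<le> card (neighbours G v \<inter> H - {x})"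
      using finN by (intro card_mono) auto
    also have "\<dots> \<le> 1"
      using few finN by (simp add: card_Diff_singleton)
    finally have 1: "card (neighbours G v \<inter> (H - {v, b, x})) \<le> 1" .
    have "card (neighbours G b \<inter> (H - {v, b, x})) \<le> card (neighbours G b \<inter> (H - {v, x}))"
      using finN by (intro card_mono) auto
    with b(2) have 2: "card (neighbours G b \<inter> (H - {v, b, x})) \<le> 3" by simp
    have "removable G H v b x"
      unfolding removable_def using 1 2 le5[of x v b] v b few irr by auto
    then show ?thesis by (rule that)
  next
    case isolated
    \<comment> \<open>\<open>{v, v}\<close> is the instance of \<open>ex\<close> that deletes
      \<open>v\<close> alone. The bound 3 for \<open>x\<close> is within the 5 allowed in third
      place.\<close>
    obtain x where x: "x \<in> H - {v, v}" "card (neighbours G x \<inter> (H - {v, v})) \<le> 3"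
      using ex by blast
    obtain b where b: "b \<in> H - {v, x}" "card (neighbours G b \<inter> (H - {v, x})) \<le> 3"
      using ex by blast
    have "card (neighbours G x \<inter> (H - {v, b, x})) \<le> card (neighbours G x \<inter> (H - {v, v}))"
      "card (neighbours G b \<inter> (H - {v, b, x})) \<le> card (neighbours G b \<inter> (H - {v, x}))"
      using finN by (intro card_mono; auto)+
    moreover have "neighbours G v \<inter> (H - {v, b, x}) = {}"
      using isolated by blast
    ultimately have "removable G H v b x"
      unfolding removable_def using v b x by auto
    then show ?thesis by (rule that)
  qed
qed

section \<open>Peeling off blocks\<close>

text \<open>Label 1 marks the vertices that have not been removed yet; the blocks \<open>j + 1, \<dots>, k\<close> are
  complete.\<close>

definition peeling :: "'a graph \<Rightarrow> nat \<Rightarrow> nat \<Rightarrow> ('a \<Rightarrow> nat) \<Rightarrow> bool" where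
  "peeling G k j B \<longleftrightarrow> 1 \<le> j \<and> j \<le> k \<and> (\<forall>v\<in>verts G. B v = 1 \<or> j < B v \<and> B v \<le> k) \<and>
     card {v \<in> verts G. B v = 1} + 3 * (k - j) = card (verts G) \<and>
     (\<forall>m\<in>{j<..k}. \<exists>a b c. removable G {v \<in> verts G. B v \<le> m} a b c \<and>
        {v \<in> verts G. B v = m} = {a, b, c})"

lemma peeling_start: "1 \<le> k \<Longrightarrow> peeling G k k (\<lambda>_. 1)"
  by (simp add: peeling_def)

text \<open>Needed because the array \<open>block\<close> of the machine agrees with the constant
  labelling 1 on the vertices only.\<close>

lemma peeling_cong:
  assumes "\<And>v. v \<in> verts G \<Longrightarrow> B v = B' v"
  shows "peeling G k j B = peeling G k j B'"
proof -
  have *: "{v \<in> verts G. P (B v)} = {v \<in> verts G. P (B' v)}" for P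
    using assms by auto
  show ?thesis
    unfolding peeling_def
    using assms *[of "\<lambda>x. x = 1"] *[of "\<lambda>x. x \<le> m" for m] *[of "\<lambda>x. x = m" for m] by simp
qed

text \<open>Every label other than 1 exceeds \<open>j\<close>, so \<open>j\<close> is free for the
  new triple, and moving vertices from label 1 to \<open>j\<close> does not disturb the completed
  blocks.\<close>

lemma peeling_step:
  assumes p: "peeling G k j B" and fin: "finite (verts G)" and j: "1 < j"
    and r: "removable G {v \<in> verts G. B v = 1} a b c"
  shows "peeling G k (j - 1) (B(a := j, b := j, c := j))"
proof -
  let ?B = "B(a := j, b := j, c := j)"
  have abc: "a \<in> verts G" "b \<in> verts G" "c \<in> verts G" "B a = 1" "B b = 1" "B c = 1"
    "a \<noteq> b" "a \<noteq> c" "b \<noteq> c"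
    using r by (auto simp: removable_def)
  have lab: "B v = 1 \<or> j < B v \<and> B v \<le> k" if "v \<in> verts G" for v
    using p that by (auto simp: peeling_def)
  have jk: "j \<le> k" using p by (simp add: peeling_def)
  have "{v \<in> verts G. ?B v = 1} = {v \<in> verts G. B v = 1} - {a, b, c}"
    using j by auto
  then have "card {v \<in> verts G. ?B v = 1} = card {v \<in> verts G. B v = 1} - card {a, b, c}"
    using fin abc by (simp only:) (intro card_Diff_subset; auto)
  moreover have "card {a, b, c} \<le> card {v \<in> verts G. B v = 1}"
    using fin abc by (intro card_mono) auto
  moreover have "card {a, b, c} = 3" using abc by simp
  moreover have "card {v \<in> verts G. B v = 1} + 3 * (k - j) = card (verts G)"
    using p by (simp add: peeling_def)
  ultimately have "card {v \<in> verts G. ?B v = 1} + 3 * (k - (j - 1)) = card (verts G)"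
    using j jk by linarith
  moreover have "\<exists>a b c. removable G {v \<in> verts G. ?B v \<le> m} a b c \<and>
      {v \<in> verts G. ?B v = m} = {a, b, c}" if m: "m \<in> {j - 1<..k}" for m
  proof (cases "m = j")
    case True
    \<comment> \<open>The vertices now labelled at most \<open>j\<close> are those formerly labelled
      1, the set in which the triple is removable.\<close>
    have "{v \<in> verts G. ?B v \<le> j} = {v \<in> verts G. B v = 1}"
      using lab j abc by force
    moreover have "{v \<in> verts G. ?B v = j} = {a, b, c}"
      using lab j abc by force
    ultimately show ?thesis using r True by metis
  next
    case False
    then have m: "m \<in> {j<..k}" using m by auto
    have "\<exists>a b c. removable G {v \<in> verts G. B v \<le> m} a b c \<and>
        {v \<in> verts G. B v = m} = {a, b, c}"
      using p m unfolding peeling_def by blast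
    moreover have "{v \<in> verts G. ?B v \<le> m} = {v \<in> verts G. B v \<le> m}"
      "{v \<in> verts G. ?B v = m} = {v \<in> verts G. B v = m}"
      using abc m j by auto
    ultimately show ?thesis by (simp only:)
  qed
  moreover have "?B v = 1 \<or> j - 1 < ?B v \<and> ?B v \<le> k" if "v \<in> verts G" for v
    using lab[OF that] j jk by auto
  ultimately show ?thesis
    unfolding peeling_def using j jk by auto
qed

text \<open>There are more than \<open>3 * k - 3\<close> vertices and \<open>3 * (k - j)\<close> are
  gone, so more than \<open>3 * (j - 1)\<close> remain.\<close>

lemma peeling_removable_exists:
  assumes "grid3d G" "peeling G k j B" "1 < j" "3 * k < card (verts G) + 3"
  obtains a b c where "removable G {v \<in> verts G. B v = 1} a b c"
proof (rule removable_exists[OF assms(1), of "{v \<in> verts G. B v = 1}"])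
  have "card {v \<in> verts G. B v = 1} + 3 * (k - j) = card (verts G)" "j \<le> k"
    using assms(2) by (auto simp: peeling_def)
  then show "3 \<le> card {v \<in> verts G. B v = 1}"
    using assms(3,4) by linarith
qed (use that in auto)

text \<open>The inequalities make \<open>k\<close> a third of the number of vertices, rounded up. So
  one, two or three vertices keep label 1, and they form the first block.\<close>

lemma peeling_kd_partition:
  assumes fin: "finite (verts G)" and p: "peeling G k 1 B"
    and k: "card (verts G) \<le> 3 * k" "3 * k < card (verts G) + 3"
  shows "kd_partition 3 2 G (map (\<lambda>j. {v \<in> verts G. B v = j}) [1..<Suc k])"
    (is "kd_partition 3 2 G ?S")
proof -
  have k1: "1 \<le> k" and lab: "\<And>v. v \<in> verts G \<Longrightarrow> B v = 1 \<or> 1 < B v \<and> B v \<le> k"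
    and c1: "card {v \<in> verts G. B v = 1} + 3 * (k - 1) = card (verts G)"
    using p by (auto simp: peeling_def)
  have blk: "\<exists>a b c. removable G {v \<in> verts G. B v \<le> m} a b c \<and>
      {v \<in> verts G. B v = m} = {a, b, c}" if "1 < m" "m \<le> k" for m
    using p that unfolding peeling_def by auto
  have nth: "?S ! j = {v \<in> verts G. B v = Suc j}" if "j < k" for j
    using that by (simp del: upt_Suc)
  \<comment> \<open>Nonemptiness also yields that the list is distinct, since different labels give
    disjoint blocks.\<close>
  have ne: "{v \<in> verts G. B v = m} \<noteq> {}" if "1 \<le> m" "m \<le> k" for m
  proof (cases "m = 1")
    case True
    have "card {v \<in> verts G. B v = 1} \<noteq> 0" using c1 k k1 by linarith
    then show ?thesis unfolding True by (metis card.empty)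
  next
    case False
    then show ?thesis using blk[of m] that by force
  qed
  have inj: "inj_on (\<lambda>j. {v \<in> verts G. B v = j}) {1..k}"
  proof (rule inj_onI)
    fix m m' assume "m \<in> {1..k}" "{v \<in> verts G. B v = m} = {v \<in> verts G. B v = m'}"
    then show "m = m'" using ne[of m] by force
  qed
  have set: "set ?S = (\<lambda>j. {v \<in> verts G. B v = j}) ` {1..k}"
    by (simp add: atLeastLessThanSuc_atLeastAtMost del: upt_Suc)
  have "partition_on (verts G) (set ?S)"
    unfolding set
  proof (rule partition_onI)
    show "\<Union> ((\<lambda>j. {v \<in> verts G. B v = j}) ` {1..k}) = verts G"
      using lab k1 by force
    show "{} \<notin> (\<lambda>j. {v \<in> verts G. B v = j}) ` {1..k}"
      using ne by (metis (no_types, lifting) atLeastAtMost_iff imageE)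
  qed (auto simp: disjnt_def)
  moreover have "distinct ?S"
    using inj by (simp add: distinct_map atLeastLessThanSuc_atLeastAtMost del: upt_Suc)
  moreover have "?S \<noteq> []" using k1 by simp
  moreover have "finite (?S ! 0)" "card (?S ! 0) \<le> 3"
    using nth[of 0] k1 fin c1 k by auto
  moreover have "card (?S ! j) = 3 \<and> (\<exists>xs. distinct xs \<and> set xs = ?S ! j \<and>
      (\<forall>i\<in>{1..3}. int (card (neighbours G (xs ! (i - 1)) \<inter> (\<Union>l<j. ?S ! l))) \<le> int 2 * int i - 1))"
    if j: "j \<in> {1..<length ?S}" for j
  proof -
    from j have jk: "1 \<le> j" "j < k" by (auto simp del: upt_Suc)
    then obtain a b c where r: "removable G {v \<in> verts G. B v \<le> Suc j} a b c"
      and abc: "{v \<in> verts G. B v = Suc j} = {a, b, c}"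
      using blk[of "Suc j"] by auto
    \<comment> \<open>Entry \<open>j\<close> of the list has label \<open>j + 1\<close>, so the
      earlier entries carry the labels 1 to \<open>j\<close>.\<close>
    have prev: "(\<Union>l<j. ?S ! l) = {v \<in> verts G. B v \<le> Suc j} - {a, b, c}"
    proof -
      have "(\<Union>l<j. ?S ! l) = (\<Union>l<j. {v \<in> verts G. B v = Suc l})"
        using jk nth by (intro SUP_cong) auto
      also have "\<dots> = {v \<in> verts G. B v \<le> Suc j} - {v \<in> verts G. B v = Suc j}"
      proof (intro equalityI subsetI)
        fix v assume "v \<in> {v \<in> verts G. B v \<le> Suc j} - {v \<in> verts G. B v = Suc j}"
        then have v: "v \<in> verts G" "B v < Suc j" by auto
        with lab[OF v(1)] have "B v - 1 < j" "B v = Suc (B v - 1)" by auto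
        with v(1) show "v \<in> (\<Union>l<j. {v \<in> verts G. B v = Suc l})" by blast
      qed auto
      finally show ?thesis unfolding abc .
    qed
    have "{1..3::nat} = {1, 2, 3}" by auto
    then have "distinct [a, b, c] \<and> set [a, b, c] = ?S ! j \<and>
      (\<forall>i\<in>{1..3}. int (card (neighbours G ([a, b, c] ! (i - 1)) \<inter> (\<Union>l<j. ?S ! l))) \<le> int 2 * int i - 1)"
      using r nth[OF jk(2)] abc unfolding prev removable_def by simp
    moreover have "card (?S ! j) = 3"
      using nth[OF jk(2)] abc r by (simp add: removable_def)
    ultimately show ?thesis by blast
  qed
  ultimately show ?thesis unfolding kd_partition_def by blast
qed

lemma peeling_exists:
  assumes "grid3d G" "3 * k < card (verts G) + 3" "1 \<le> k"
  shows "\<exists>B. peeling G k 1 B"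
proof -
  have "1 \<le> j \<Longrightarrow> \<exists>B. peeling G k j B" if "j \<le> k" for j
    using that
  \<comment> \<open>The induction descends from \<open>j = k\<close>, where all labels are
    1.\<close>
  proof (induction rule: inc_induct)
    case base
    then show ?case using assms(3) peeling_start by blast
  next
    case (step j)
    then obtain B where B: "peeling G k (Suc j) B" by auto
    then obtain a b c where "removable G {v \<in> verts G. B v = 1} a b c"
      using peeling_removable_exists[OF assms(1) B] assms(2) step.prems by auto
    from peeling_step[OF B _ _ this] show ?case
      using assms(1) step.prems by (auto simp: grid3d_def simple_graph_def)
  qed
  with assms(3) show ?thesis by blast
qed

lemma grid3d_kd_partition:
  assumes "grid3d G"
  shows "\<exists>S. kd_partition 3 2 G S"
proof -
  from assms have fin: "finite (verts G)" by (simp add: grid3d_def simple_graph_def)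
  define k where "k = (card (verts G) + 2) div 3"
  have k: "card (verts G) \<le> 3 * k" "3 * k < card (verts G) + 3"
    unfolding k_def by linarith+
  have "verts G \<noteq> {}" using assms by (rule grid3d_nonempty)
  then have "1 \<le> k" using k(1) fin by (cases k) auto
  with assms k(2) obtain B where "peeling G k 1 B" using peeling_exists by blast
  from peeling_kd_partition[OF fin this k] show ?thesis by blast
qed

section \<open>Programs with at most \<open>n\<close> iterations per loop\<close>

fun straight :: "com \<Rightarrow> bool" where
  "straight Skip \<longleftrightarrow> True"
| "straight (Write x a b) \<longleftrightarrow> True"
| "straight (Seq c d) \<longleftrightarrow> straight c \<and> straight d"
| "straight (Cond b c d) \<longleftrightarrow> straight c \<and> straight d"
| "straight (While b c) \<longleftrightarrow> False"

text \<open>The value on loops is irrelevant.\<close>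

fun run :: "com \<Rightarrow> state \<Rightarrow> state" where
  "run Skip s = s"
| "run (Write x a b) s = s(x := (s x)(aval a s := aval b s))"
| "run (Seq c d) s = run d (run c s)"
| "run (Cond b c d) s = (if bval b s then run c s else run d s)"
| "run (While b c) s = s"

text \<open>A bound, in the value of the variable \<open>n\<close>, on the running time of a program in which no
  execution of a loop makes more than \<open>n\<close> iterations.\<close>

fun bound :: "com \<Rightarrow> nat poly" where
  "bound Skip = 1"
| "bound (Write x a b) = [:1 + acost a + acost b:]"
| "bound (Seq c d) = bound c + bound d"
| "bound (Cond b c d) = [:1 + bcost b:] + bound c + bound d"
| "bound (While b c) = [:1 + bcost b:] + [:0, 1:] * ([:1 + bcost b:] + bound c)"

text \<open>Without loops the bound is a constant polynomial, so its argument \<open>m\<close> is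
  arbitrary.\<close>

lemma exec_straight: "straight c \<Longrightarrow> \<exists>t. exec c s t (run c s) \<and> t \<le> poly (bound c) m"
proof (induction c arbitrary: s)
  case Skip
  then show ?case using exec.Skip by force
next
  case (Write x a b)
  have "exec (Write x a b) s (1 + acost a + acost b) (run (Write x a b) s)"
    unfolding run.simps by (rule exec.Write)
  moreover have "1 + acost a + acost b \<le> poly (bound (Write x a b)) m" by simp
  ultimately show ?case by blast
next
  case (Seq c d)
  then obtain t u where "exec c s t (run c s)" "t \<le> poly (bound c) m"
    "exec d (run c s) u (run d (run c s))" "u \<le> poly (bound d) m"
    by fastforce
  then have "exec (Seq c d) s (t + u) (run (Seq c d) s)" "t + u \<le> poly (bound (Seq c d)) m"
    by (auto intro: exec.Seq)
  then show ?case by blast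
next
  case (Cond b c d)
  show ?case
  proof (cases "bval b s")
    case True
    from Cond obtain t where "exec c s t (run c s)" "t \<le> poly (bound c) m" by fastforce
    then show ?thesis using exec.CondTrue[OF True] True by fastforce
  next
    case False
    from Cond obtain t where "exec d s t (run d s)" "t \<le> poly (bound d) m" by fastforce
    then show ?thesis using exec.CondFalse[OF False] False by fastforce
  qed
qed simp

text \<open>Total correctness with the time bound built in. Preservation of \<open>n\<close> is
  included so that the bounds of successive programs are evaluated at the same argument.\<close>

definition hoare :: "(state \<Rightarrow> bool) \<Rightarrow> com \<Rightarrow> (state \<Rightarrow> bool) \<Rightarrow> bool" where
  "hoare P c Q \<longleftrightarrow> (\<forall>s. P s \<longrightarrow> (\<exists>t s'. exec c s t s' \<and> t \<le> poly (bound c) (s ''n'' 0) \<and>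
     s' ''n'' 0 = s ''n'' 0 \<and> Q s'))"

lemma hoare_straight:
  assumes "straight c" "\<And>s. P s \<Longrightarrow> run c s ''n'' 0 = s ''n'' 0 \<and> Q (run c s)"
  shows "hoare P c Q"
  using assms exec_straight unfolding hoare_def by metis

lemma hoare_weaken:
  assumes "hoare P c Q" "\<And>s. P' s \<Longrightarrow> P s" "\<And>s. Q s \<Longrightarrow> Q' s"
  shows "hoare P' c Q'"
  using assms unfolding hoare_def by metis

lemma hoare_Seq:
  assumes "hoare P c R" "hoare R d Q"
  shows "hoare P (Seq c d) Q"
  unfolding hoare_def
proof (intro allI impI)
  fix s assume "P s"
  then obtain t s1 where c: "exec c s t s1" "t \<le> poly (bound c) (s ''n'' 0)"
    "s1 ''n'' 0 = s ''n'' 0" "R s1"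
    using assms(1) unfolding hoare_def by blast
  then obtain u s2 where "exec d s1 u s2" "u \<le> poly (bound d) (s1 ''n'' 0)"
    "s2 ''n'' 0 = s1 ''n'' 0" "Q s2"
    using assms(2) unfolding hoare_def by blast
  with c have "exec (Seq c d) s (t + u) s2" "t + u \<le> poly (bound (Seq c d)) (s ''n'' 0)"
    "s2 ''n'' 0 = s ''n'' 0" "Q s2"
    by (auto intro: exec.Seq)
  then show "\<exists>t s'. exec (Seq c d) s t s' \<and> t \<le> poly (bound (Seq c d)) (s ''n'' 0) \<and>
      s' ''n'' 0 = s ''n'' 0 \<and> Q s'" by blast
qed

lemma hoare_Cond:
  assumes "hoare (\<lambda>s. P s \<and> bval b s) c Q" "hoare (\<lambda>s. P s \<and> \<not> bval b s) d Q"
  shows "hoare P (Cond b c d) Q"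
  unfolding hoare_def
proof (intro allI impI)
  fix s assume P: "P s"
  show "\<exists>t s'. exec (Cond b c d) s t s' \<and> t \<le> poly (bound (Cond b c d)) (s ''n'' 0) \<and>
      s' ''n'' 0 = s ''n'' 0 \<and> Q s'"
  proof (cases "bval b s")
    case True
    then obtain t s' where "exec c s t s'" "t \<le> poly (bound c) (s ''n'' 0)"
      "s' ''n'' 0 = s ''n'' 0" "Q s'"
      using assms(1) P unfolding hoare_def by blast
    then show ?thesis using exec.CondTrue[OF True] by fastforce
  next
    case False
    then obtain t s' where "exec d s t s'" "t \<le> poly (bound d) (s ''n'' 0)"
      "s' ''n'' 0 = s ''n'' 0" "Q s'"
      using assms(2) P unfolding hoare_def by blast
    then show ?thesis using exec.CondFalse[OF False] by fastforce
  qed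
qed

section \<open>Counting loops\<close>

abbreviation V :: "vname \<Rightarrow> aexp" where
  "V x \<equiv> Read x (Const 0)"

abbreviation Assign :: "vname \<Rightarrow> aexp \<Rightarrow> com" where
  "Assign x e \<equiv> Write x (Const 0) e"

abbreviation Iterate :: "vname \<Rightarrow> com \<Rightarrow> com" where
  "Iterate x c \<equiv> While (Less (V x) (V ''n'')) (Seq c (Assign x (Add (V x) (Const 1))))"

definition For :: "vname \<Rightarrow> com \<Rightarrow> com" where
  "For x c = Seq (Assign x (Const 0)) (Iterate x c)"

text \<open>A failed test costs 6, and each of the \<open>n - i\<close> remaining rounds spends 6 on
  the test and 6 on the increment besides its body. Stability carries the invariant over the update
  of the counter.\<close>

lemma exec_Iterate:
  assumes step: "\<And>i. i < n \<Longrightarrow> hoare (\<lambda>s. I i s \<and> s x 0 = i) c (\<lambda>s. I (Suc i) s \<and> s x 0 = i)"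
    and stable: "\<And>i s v. I i s \<Longrightarrow> I i (s(x := (s x)(0 := v)))"
    and n: "\<And>i s. I i s \<Longrightarrow> s ''n'' 0 = n"
    and "i \<le> n" "I i s" "s x 0 = i"
  shows "\<exists>t s'. exec (Iterate x c) s t s' \<and> t \<le> 6 + (n - i) * (12 + poly (bound c) n) \<and> I n s'"
  using assms(4-6)
proof (induction i arbitrary: s rule: inc_induct)
  case base
  have "exec (Iterate x c) s (1 + bcost (Less (V x) (V ''n''))) s"
    by (rule exec.WhileFalse) (use base n in auto)
  then have "exec (Iterate x c) s 6 s" by (simp add: numeral_eq_Suc)
  with base show ?case by auto
next
  case (step i)
  have test: "bval (Less (V x) (V ''n'')) s"
    using step.prems step.hyps n by auto
  have "s ''n'' 0 = n" using n step.prems by blast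
  then obtain t1 s1 where c: "exec c s t1 s1" "t1 \<le> poly (bound c) n" "I (Suc i) s1" "s1 x 0 = i"
    using assms(1)[OF step.hyps(2)] step.prems unfolding hoare_def by blast
  let ?s2 = "s1(x := (s1 x)(0 := Suc i))"
  have "exec (Assign x (Add (V x) (Const 1))) s1 6 ?s2"
    using exec.Write[of x "Const 0" "Add (V x) (Const 1)" s1] c(4)
    by (simp add: numeral_eq_Suc)
  with c(1) have body: "exec (Seq c (Assign x (Add (V x) (Const 1)))) s (t1 + 6) ?s2"
    by (rule exec.Seq)
  have "\<exists>t s'. exec (Iterate x c) ?s2 t s' \<and>
      t \<le> 6 + (n - Suc i) * (12 + poly (bound c) n) \<and> I n s'"
    by (rule step.IH[OF stable[OF c(3)]]) simp
  then obtain t s' where t: "exec (Iterate x c) ?s2 t s'"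
    "t \<le> 6 + (n - Suc i) * (12 + poly (bound c) n)" "I n s'"
    by blast
  have "exec (Iterate x c) s (12 + t1 + t) s'"
    using exec.WhileTrue[OF test body t(1)] by (simp add: algebra_simps)
  moreover have "n - i = Suc (n - Suc i)" using step.hyps by simp
  then have "12 + t1 + t \<le> 6 + (n - i) * (12 + poly (bound c) n)"
    using t(2) c(2) by simp
  ultimately show ?case using t(3) by blast
qed

lemma hoare_For:
  assumes "\<And>i. i < n \<Longrightarrow> hoare (\<lambda>s. I i s \<and> s x 0 = i) c (\<lambda>s. I (Suc i) s \<and> s x 0 = i)"
    and stable: "\<And>i s v. I i s \<Longrightarrow> I i (s(x := (s x)(0 := v)))"
    and n: "\<And>i s. I i s \<Longrightarrow> s ''n'' 0 = n"
  shows "hoare (I 0) (For x c) (I n)"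
  unfolding hoare_def
proof (intro allI impI)
  fix s assume I: "I 0 s"
  let ?s = "s(x := (s x)(0 := 0))"
  have "\<exists>t s'. exec (Iterate x c) ?s t s' \<and> t \<le> 6 + (n - 0) * (12 + poly (bound c) n) \<and> I n s'"
  proof (rule exec_Iterate[where I = I])
    show "I i (s(x := (s x)(0 := v)))" if "I i s" for i s v using that by (rule stable)
    show "I 0 ?s" using I by (rule stable)
  qed (simp_all add: assms(1) n)
  then obtain t s' where t: "exec (Iterate x c) ?s t s'" "t \<le> 6 + n * (12 + poly (bound c) n)" "I n s'"
    by auto
  have "exec (Assign x (Const 0)) s 3 ?s"
    using exec.Write[of x "Const 0" "Const 0" s]
    by (simp add: numeral_eq_Suc)
  then have "exec (For x c) s (3 + t) s'"
    unfolding For_def using t(1) by (rule exec.Seq)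
  moreover have "3 + t \<le> poly (bound (For x c)) (s ''n'' 0)"
    using t(2) n[OF I] by (simp add: For_def algebra_simps)
  ultimately show "\<exists>t s'. exec (For x c) s t s' \<and> t \<le> poly (bound (For x c)) (s ''n'' 0) \<and>
      s' ''n'' 0 = s ''n'' 0 \<and> I n s'"
    using t(3) n[OF I] n[OF t(3)] by auto
qed

section \<open>The algorithm\<close>

text \<open>As the machine cannot multiply, the offset of each row of the adjacency matrix is tabulated
  in the array \<open>row\<close>. The same loop raises \<open>blocks\<close> until it reaches a third of \<open>n\<close>, rounded
  up.\<close>

definition init_step :: com where
  "init_step = Seq (Write ''block'' (V ''i'') (Const 1))
    (Seq (Write ''row'' (Add (V ''i'') (Const 1)) (Add (Read ''row'' (V ''i'')) (V ''n'')))
      (Cond (Less (Add (V ''blocks'') (Add (V ''blocks'') (V ''blocks''))) (V ''n''))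
        (Assign ''blocks'' (Add (V ''blocks'') (Const 1))) Skip))"

text \<open>Matrix entries are 0 or 1, so adding them counts neighbours without a branch.\<close>

definition tally :: "vname \<Rightarrow> vname \<Rightarrow> com" where
  "tally x d = Assign d (Add (V d) (Read ''adj'' (Add (Read ''row'' (V x)) (V ''u''))))"

definition count_step :: com where
  "count_step =
    Cond (Conj (Equal (Read ''block'' (V ''u'')) (Const 1)) (Conj (Neg (Equal (V ''u'') (V ''a'')))
        (Conj (Neg (Equal (V ''u'') (V ''b''))) (Neg (Equal (V ''u'') (V ''c''))))))
      (Seq (tally ''a'' ''da'') (Seq (tally ''b'' ''db'') (tally ''c'' ''dc''))) Skip"

definition reset :: com where
  "reset = Seq (Assign ''da'' (Const 0)) (Seq (Assign ''db'' (Const 0)) (Assign ''dc'' (Const 0)))"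

definition accept :: com where
  "accept =
    Cond (Conj (Less (V ''da'') (Const 2)) (Conj (Less (V ''db'') (Const 4)) (Less (V ''dc'') (Const 6))))
      (Seq (Write ''block'' (V ''a'') (V ''j'')) (Seq (Write ''block'' (V ''b'') (V ''j''))
        (Seq (Write ''block'' (V ''c'') (V ''j'')) (Assign ''found'' (Const 1))))) Skip"

text \<open>A counting loop cannot be left early; the test of \<open>found\<close> makes the triples
  after a success idle instead.\<close>

definition candidate :: bexp where
  "candidate = Conj (Equal (V ''found'') (Const 0))
    (Conj (Equal (Read ''block'' (V ''a'')) (Const 1)) (Conj (Equal (Read ''block'' (V ''b'')) (Const 1))
    (Conj (Equal (Read ''block'' (V ''c'')) (Const 1)) (Conj (Neg (Equal (V ''a'') (V ''b'')))
    (Conj (Neg (Equal (V ''a'') (V ''c''))) (Neg (Equal (V ''b'') (V ''c''))))))))"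

definition try_triple :: com where
  "try_triple = Cond candidate (Seq reset (Seq (For ''u'' count_step) accept)) Skip"

definition search :: com where
  "search = For ''a'' (For ''b'' (For ''c'' try_triple))"

definition split_block :: com where
  "split_block = Cond (Less (Const 1) (V ''j''))
    (Seq (Assign ''found'' (Const 0)) (Seq search (Assign ''j'' (Sub (V ''j'') (Const 1))))) Skip"

text \<open>The last loop makes \<open>n\<close> rounds so that it is a counting loop too; once
  \<open>j\<close> is 1, a round changes no label.\<close>

definition algorithm :: com where
  "algorithm = Seq (For ''i'' init_step) (Seq (Assign ''j'' (V ''blocks'')) (For ''r'' split_block))"

section \<open>Correctness of the algorithm on a labelled grid\<close>

locale labelled_grid =
  fixes G :: "nat graph" and n :: nat
  assumes grid: "grid3d G" and verts: "verts G = {..<n}"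
begin

text \<open>Addressing by row and column replaces the \<open>div\<close> and \<open>mod\<close> of
  \<open>graph_input\<close> and fits the addresses computed by \<open>tally\<close>.\<close>

definition input :: "state \<Rightarrow> bool" where
  "input s \<longleftrightarrow> s ''n'' 0 = n \<and> (\<forall>u<n. \<forall>v<n. s ''adj'' (u * n + v) = of_bool (adj G u v))"

definition frame :: "nat \<Rightarrow> nat \<Rightarrow> state \<Rightarrow> bool" where
  "frame k j s \<longleftrightarrow> input s \<and> (\<forall>u<n. s ''row'' u = u * n) \<and> s ''blocks'' 0 = k \<and> s ''j'' 0 = j"

abbreviation rest :: "(nat \<Rightarrow> nat) \<Rightarrow> nat set" where
  "rest B \<equiv> {v \<in> verts G. B v = 1}"

text \<open>The state during the search for the block \<open>j\<close> in round \<open>r\<close>, where \<open>B\<close> is the labelling at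
  the start of the round and \<open>E\<close> records which triples have been ruled out.\<close>

definition searching :: "nat \<Rightarrow> nat \<Rightarrow> nat \<Rightarrow> (nat \<Rightarrow> nat) \<Rightarrow> bool \<Rightarrow> state \<Rightarrow> bool" where
  "searching k j r B E s \<longleftrightarrow> frame k j s \<and> s ''r'' 0 = r \<and>
    (s ''found'' 0 = 1 \<and>
       (\<exists>a b c. removable G (rest B) a b c \<and> s ''block'' = B(a := j, b := j, c := j)) \<or>
     s ''found'' 0 = 0 \<and> s ''block'' = B \<and> E)"

text \<open>A partial degree count, written as a sum so that one pass of the counting loop adds one
  term.\<close>

definition tallied :: "(nat \<Rightarrow> nat) \<Rightarrow> nat set \<Rightarrow> nat \<Rightarrow> nat \<Rightarrow> nat" where
  "tallied B T x i = (\<Sum>u<i. of_bool (B u = 1 \<and> u \<notin> T \<and> adj G x u))"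

lemma tallied_eq_card: "tallied B T x n = card (neighbours G x \<inter> (rest B - T))"
proof -
  have "{..<n} \<inter> {u. B u = 1 \<and> u \<notin> T \<and> adj G x u} = neighbours G x \<inter> (rest B - T)"
    using verts by (auto simp: neighbours_def)
  then show ?thesis by (simp add: tallied_def)
qed

text \<open>\<open>E\<close> does not depend on the state; it is carried through the count so that
  \<open>accept\<close> can extend it.\<close>

definition counting :: "nat \<Rightarrow> nat \<Rightarrow> nat \<Rightarrow> (nat \<Rightarrow> nat) \<Rightarrow> bool \<Rightarrow> nat \<Rightarrow> nat \<Rightarrow> nat \<Rightarrow> nat \<Rightarrow> state \<Rightarrow> bool"
  where "counting k j r B E a b c i s \<longleftrightarrow> frame k j s \<and> s ''r'' 0 = r \<and>
    s ''found'' 0 = 0 \<and> s ''block'' = B \<and> E \<and> s ''a'' 0 = a \<and> s ''b'' 0 = b \<and> s ''c'' 0 = c \<and>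
    B a = 1 \<and> B b = 1 \<and> B c = 1 \<and> a \<noteq> b \<and> a \<noteq> c \<and> b \<noteq> c \<and>
    s ''da'' 0 = tallied B {a, b, c} a i \<and> s ''db'' 0 = tallied B {a, b, c} b i \<and>
    s ''dc'' 0 = tallied B {a, b, c} c i"

lemma hoare_count_step:
  assumes "i < n" "a < n" "b < n" "c < n"
  shows "hoare (\<lambda>s. counting k j r B E a b c i s \<and> s ''u'' 0 = i) count_step
    (\<lambda>s. counting k j r B E a b c (Suc i) s \<and> s ''u'' 0 = i)"
proof (rule hoare_straight)
  show "straight count_step" by (simp add: count_step_def tally_def)
qed (use assms in \<open>auto simp: count_step_def tally_def counting_def frame_def input_def tallied_def\<close>)

lemma hoare_accept:
  assumes "a < n" "b < n" "c < n"
  shows "hoare (counting k j r B E a b c n) accept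
    (\<lambda>s. searching k j r B (E \<and> \<not> removable G (rest B) a b c) s \<and>
       s ''a'' 0 = a \<and> s ''b'' 0 = b \<and> s ''c'' 0 = c)"
proof (rule hoare_straight)
  show "straight accept" by (simp add: accept_def)
  fix s assume s: "counting k j r B E a b c n s"
  let ?ok = "s ''da'' 0 < 2 \<and> s ''db'' 0 < 4 \<and> s ''dc'' 0 < 6"
  \<comment> \<open>After a full pass the tallies are the cardinalities in
    \<open>removable\<close>.\<close>
  have ok: "removable G (rest B) a b c \<longleftrightarrow> ?ok"
    using s assms unfolding counting_def tallied_eq_card removable_def by (auto simp: verts)
  show "run accept s ''n'' 0 = s ''n'' 0 \<and>
    searching k j r B (E \<and> \<not> removable G (rest B) a b c) (run accept s) \<and>
    run accept s ''a'' 0 = a \<and> run accept s ''b'' 0 = b \<and> run accept s ''c'' 0 = c"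
  proof (cases ?ok)
    case True
    then have "removable G (rest B) a b c" using ok by blast
    moreover have "run accept s ''block'' = B(a := j, b := j, c := j)"
      "run accept s ''found'' 0 = 1"
      using True s by (auto simp: accept_def counting_def frame_def)
    ultimately show ?thesis
      using True s unfolding searching_def by (auto simp: accept_def counting_def frame_def input_def)
  next
    case False
    then show ?thesis
      using s ok unfolding searching_def by (auto simp: accept_def counting_def)
  qed
qed

lemma hoare_try_triple:
  assumes "a < n" "b < n" "c < n"
  shows "hoare (\<lambda>s. searching k j r B E s \<and> s ''a'' 0 = a \<and> s ''b'' 0 = b \<and> s ''c'' 0 = c)
    try_triple
    (\<lambda>s. searching k j r B (E \<and> \<not> removable G (rest B) a b c) s \<and>
       s ''a'' 0 = a \<and> s ''b'' 0 = b \<and> s ''c'' 0 = c)"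
  unfolding try_triple_def
proof (rule hoare_Cond)
  let ?P = "\<lambda>s. searching k j r B E s \<and> s ''a'' 0 = a \<and> s ''b'' 0 = b \<and> s ''c'' 0 = c"
  let ?Q = "\<lambda>s. searching k j r B (E \<and> \<not> removable G (rest B) a b c) s \<and>
       s ''a'' 0 = a \<and> s ''b'' 0 = b \<and> s ''c'' 0 = c"
  have "hoare (\<lambda>s. ?P s \<and> bval candidate s) reset (counting k j r B E a b c 0)"
    by (rule hoare_straight)
      (auto simp: reset_def candidate_def searching_def counting_def frame_def input_def tallied_def)
  moreover have "hoare (counting k j r B E a b c 0) (For ''u'' count_step) (counting k j r B E a b c n)"
    by (rule hoare_For)
      (use assms in \<open>auto intro!: hoare_count_step, auto simp: counting_def frame_def input_def\<close>)
  ultimately show "hoare (\<lambda>s. ?P s \<and> bval candidate s)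
      (Seq reset (Seq (For ''u'' count_step) accept)) ?Q"
    using hoare_accept[OF assms] by (meson hoare_Seq)
  \<comment> \<open>A triple is skipped either after a success, where \<open>E\<close> is not
    asserted, or because it fails membership or distinctness in \<open>removable\<close> and is thus
    ruled out.\<close>
  show "hoare (\<lambda>s. ?P s \<and> \<not> bval candidate s) Skip ?Q"
    by (rule hoare_straight) (auto simp: searching_def candidate_def removable_def)
qed

text \<open>Each of the three loops contributes one bounded quantifier to \<open>E\<close>, ranging
  over the indices below its counter.\<close>

lemma hoare_search:
  "hoare (searching k j r B True) search
    (searching k j r B (\<forall>a<n. \<forall>b<n. \<forall>c<n. \<not> removable G (rest B) a b c))"
proof -
  let ?R = "removable G (rest B)"
  have c_loop: "hoare (\<lambda>s. searching k j r B E s \<and> s ''a'' 0 = a \<and> s ''b'' 0 = b)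
      (For ''c'' try_triple)
      (\<lambda>s. searching k j r B (E \<and> (\<forall>c<n. \<not> ?R a b c)) s \<and> s ''a'' 0 = a \<and> s ''b'' 0 = b)"
    if "a < n" "b < n" for E a b
  proof (rule hoare_weaken)
    let ?I = "\<lambda>i s. searching k j r B (E \<and> (\<forall>c<i. \<not> ?R a b c)) s \<and> s ''a'' 0 = a \<and> s ''b'' 0 = b"
    show "hoare (?I 0) (For ''c'' try_triple) (?I n)"
    proof (rule hoare_For)
      fix i assume "i < n"
      from hoare_try_triple[OF that this, of k j r B "E \<and> (\<forall>c<i. \<not> ?R a b c)"]
      show "hoare (\<lambda>s. ?I i s \<and> s ''c'' 0 = i) try_triple (\<lambda>s. ?I (Suc i) s \<and> s ''c'' 0 = i)"
        by (rule hoare_weaken) (auto simp: less_Suc_eq searching_def)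
    qed (auto simp: searching_def frame_def input_def)
  qed auto
  have b_loop: "hoare (\<lambda>s. searching k j r B E s \<and> s ''a'' 0 = a)
      (For ''b'' (For ''c'' try_triple))
      (\<lambda>s. searching k j r B (E \<and> (\<forall>b<n. \<forall>c<n. \<not> ?R a b c)) s \<and> s ''a'' 0 = a)"
    if "a < n" for E a
  proof (rule hoare_weaken)
    let ?I = "\<lambda>i s. searching k j r B (E \<and> (\<forall>b<i. \<forall>c<n. \<not> ?R a b c)) s \<and> s ''a'' 0 = a"
    show "hoare (?I 0) (For ''b'' (For ''c'' try_triple)) (?I n)"
    proof (rule hoare_For)
      fix i assume "i < n"
      from c_loop[OF that this, of "E \<and> (\<forall>b<i. \<forall>c<n. \<not> ?R a b c)"]
      show "hoare (\<lambda>s. ?I i s \<and> s ''b'' 0 = i) (For ''c'' try_triple)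
          (\<lambda>s. ?I (Suc i) s \<and> s ''b'' 0 = i)"
        by (rule hoare_weaken) (auto simp: less_Suc_eq searching_def)
    qed (auto simp: searching_def frame_def input_def)
  qed auto
  show ?thesis
    unfolding search_def
  proof (rule hoare_weaken)
    let ?I = "\<lambda>i s. searching k j r B (\<forall>a<i. \<forall>b<n. \<forall>c<n. \<not> ?R a b c) s"
    show "hoare (?I 0) (For ''a'' (For ''b'' (For ''c'' try_triple))) (?I n)"
    proof (rule hoare_For)
      fix i assume "i < n"
      from b_loop[OF this, of "\<forall>a<i. \<forall>b<n. \<forall>c<n. \<not> ?R a b c"]
      show "hoare (\<lambda>s. ?I i s \<and> s ''a'' 0 = i) (For ''b'' (For ''c'' try_triple))
          (\<lambda>s. ?I (Suc i) s \<and> s ''a'' 0 = i)"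
        by (rule hoare_weaken) (auto simp: less_Suc_eq searching_def)
    qed (auto simp: searching_def frame_def input_def)
  qed auto
qed

text \<open>After \<open>i\<close> rounds \<open>j\<close> is \<open>k - i\<close>, until it reaches
  1 and stays there.\<close>

definition peeled :: "nat \<Rightarrow> nat \<Rightarrow> state \<Rightarrow> bool" where
  "peeled k i s \<longleftrightarrow> (\<exists>j. frame k j s \<and> peeling G k j (s ''block'') \<and> (j = 1 \<or> j + i = k))"

lemma hoare_split_block:
  assumes k: "3 * k < n + 3"
  shows "hoare (\<lambda>s. peeled k i s \<and> s ''r'' 0 = i) split_block
    (\<lambda>s. peeled k (Suc i) s \<and> s ''r'' 0 = i)"
proof -
  have fin: "finite (verts G)" by (simp add: verts)
  have "hoare (\<lambda>s. (frame k j s \<and> s ''block'' = B \<and> s ''r'' 0 = i) \<and> bval (Less (Const 1) (V ''j'')) s)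
      (Seq (Assign ''found'' (Const 0)) (Seq search (Assign ''j'' (Sub (V ''j'') (Const 1)))))
      (\<lambda>s. peeled k (Suc i) s \<and> s ''r'' 0 = i)"
    if p: "peeling G k j B" and j: "1 < j" "j = 1 \<or> j + i = k" for j B
  proof (intro hoare_Seq)
    show "hoare (\<lambda>s. (frame k j s \<and> s ''block'' = B \<and> s ''r'' 0 = i) \<and>
        bval (Less (Const 1) (V ''j'')) s) (Assign ''found'' (Const 0)) (searching k j i B True)"
      by (rule hoare_straight) (auto simp: searching_def frame_def input_def)
    show "hoare (searching k j i B True) search
      (searching k j i B (\<forall>a<n. \<forall>b<n. \<forall>c<n. \<not> removable G (rest B) a b c))"
      by (rule hoare_search)
    \<comment> \<open>An exhaustive search without success would contradict the existence of a
      removable triple, so the \<open>found\<close> alternative holds.\<close>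
    have "\<not> (\<forall>a<n. \<forall>b<n. \<forall>c<n. \<not> removable G (rest B) a b c)"
    proof -
      obtain a b c where "removable G (rest B) a b c"
        using peeling_removable_exists[OF grid p j(1)] k verts by auto
      then show ?thesis by (auto simp: removable_def verts)
    qed
    moreover have "peeling G k (j - 1) (s ''block'')"
      if "removable G (rest B) a b c" "s ''block'' = B(a := j, b := j, c := j)" for s :: state and a b c
      using peeling_step[OF p fin j(1) that(1)] that(2) by simp
    ultimately show "hoare (searching k j i B (\<forall>a<n. \<forall>b<n. \<forall>c<n. \<not> removable G (rest B) a b c))
      (Assign ''j'' (Sub (V ''j'') (Const 1))) (\<lambda>s. peeled k (Suc i) s \<and> s ''r'' 0 = i)"
      using j by (intro hoare_straight)
        (auto simp: searching_def peeled_def frame_def input_def intro!: exI[of _ "j - 1"])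
  qed
  \<comment> \<open>The values \<open>j\<close> and \<open>B\<close>, fixed so far, are now read off
    the starting state.\<close>
  then have 1: "hoare (\<lambda>s. (peeled k i s \<and> s ''r'' 0 = i) \<and> bval (Less (Const 1) (V ''j'')) s)
      (Seq (Assign ''found'' (Const 0)) (Seq search (Assign ''j'' (Sub (V ''j'') (Const 1)))))
      (\<lambda>s. peeled k (Suc i) s \<and> s ''r'' 0 = i)"
    unfolding hoare_def peeled_def by (fastforce simp: frame_def)
  have 2: "hoare (\<lambda>s. (peeled k i s \<and> s ''r'' 0 = i) \<and> \<not> bval (Less (Const 1) (V ''j'')) s) Skip
      (\<lambda>s. peeled k (Suc i) s \<and> s ''r'' 0 = i)"
    by (rule hoare_straight) (auto simp: peeled_def frame_def peeling_def)
  from 1 2 show ?thesis unfolding split_block_def by (rule hoare_Cond)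
qed

text \<open>The conditions on \<open>blocks\<close> describe the minimum of \<open>i\<close> and a
  third of \<open>n\<close>, rounded up. \<open>row\<close> is one entry ahead because each pass
  computes the next offset.\<close>

definition initialised :: "nat \<Rightarrow> state \<Rightarrow> bool" where
  "initialised i s \<longleftrightarrow> input s \<and> (\<forall>u\<le>i. s ''row'' u = u * n) \<and> (\<forall>u<i. s ''block'' u = 1) \<and>
    s ''blocks'' 0 \<le> i \<and> 3 * s ''blocks'' 0 < n + 3 \<and> (n \<le> 3 * s ''blocks'' 0 \<or> s ''blocks'' 0 = i)"

lemma hoare_init: "hoare (initialised 0) (For ''i'' init_step) (initialised n)"
proof (rule hoare_For)
  fix i assume "i < n"
  show "hoare (\<lambda>s. initialised i s \<and> s ''i'' 0 = i) init_step
    (\<lambda>s. initialised (Suc i) s \<and> s ''i'' 0 = i)"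
    by (rule hoare_straight)
      (auto simp: init_step_def initialised_def input_def le_Suc_eq less_Suc_eq)
qed (auto simp: initialised_def input_def)

lemma hoare_algorithm:
  "hoare (initialised 0) algorithm (\<lambda>s. kd_partition 3 2 G (blocks_output n s))"
proof -
  define k where "k = (n + 2) div 3"
  have k: "n \<le> 3 * k" "3 * k < n + 3" unfolding k_def by linarith+
  have "0 < n" using grid3d_nonempty[OF grid] by (simp add: verts lessThan_empty_iff)
  then have k1: "1 \<le> k" "k \<le> n" using k by linarith+
  have "hoare (initialised n) (Assign ''j'' (V ''blocks'')) (peeled k 0)"
  proof (rule hoare_straight)
    fix s assume s: "initialised n s"
    \<comment> \<open>At \<open>i = n\<close> both alternatives of the invariant give
      \<open>n \<le> 3 * blocks\<close>, and the strict bound leaves only \<open>k\<close>.\<close>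
    then have "s ''blocks'' 0 = k" using k by (auto simp: initialised_def)
    moreover have "peeling G k k (s ''block'')"
      using peeling_start[OF k1(1), of G] peeling_cong[of G "s ''block''" "\<lambda>_. 1" k k] s
      by (simp add: verts initialised_def)
    ultimately show "run (Assign ''j'' (V ''blocks'')) s ''n'' 0 = s ''n'' 0 \<and>
      peeled k 0 (run (Assign ''j'' (V ''blocks'')) s)"
      using s by (auto simp: peeled_def frame_def initialised_def input_def)
  qed simp
  moreover have "hoare (peeled k 0) (For ''r'' split_block) (peeled k n)"
    by (rule hoare_For)
      (use k in \<open>auto intro!: hoare_split_block, auto simp: peeled_def frame_def input_def\<close>)
  ultimately have *: "hoare (initialised 0) algorithm (peeled k n)"
    using hoare_init unfolding algorithm_def by (meson hoare_Seq)
  show ?thesis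
  proof (rule hoare_weaken[OF *])
    fix s assume "peeled k n s"
    \<comment> \<open>\<open>j + n = k\<close> is impossible for \<open>1 \<le> j\<close> and
      \<open>k \<le> n\<close>, so \<open>j = 1\<close> after \<open>n\<close> rounds.\<close>
    then have "s ''blocks'' 0 = k" "peeling G k 1 (s ''block'')"
      using k1 by (auto simp: peeled_def frame_def peeling_def)
    then show "kd_partition 3 2 G (blocks_output n s)"
      using peeling_kd_partition[of G k "s ''block''"] k verts
      by (simp add: blocks_output_def del: upt_Suc)
  qed
qed

lemma initialised_graph_input: "initialised 0 (graph_input G)"
proof -
  have "u * n + v < n * n" if "u < n" "v < n" for u v
  proof -
    have "u * n + v < Suc u * n" using that by simp
    also have "\<dots> \<le> n * n" using that by (intro mult_right_mono) auto
    finally show ?thesis .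
  qed
  then show ?thesis
    by (auto simp: initialised_def input_def graph_input_def verts)
qed

end

theorem theorem4:
  "(\<exists>(c :: com) (p :: nat poly). \<forall>G :: nat graph.
      grid3d G \<and> verts G = {..<card (verts G)} \<longrightarrow>
      (\<exists>t s. exec c (graph_input G) t s \<and> t \<le> poly p (card (verts G)) \<and>
             kd_partition 3 2 G (blocks_output (card (verts G)) s)))
   \<and> (\<forall>G :: 'a graph. grid3d G \<longrightarrow> (\<exists>S. kd_partition 3 2 G S))"
proof -
  \<comment> \<open>Program and polynomial are the same for all graphs; only the interpreted locale
    depends on \<open>G\<close>.\<close>
  have "\<exists>t s. exec algorithm (graph_input G) t s \<and>
      t \<le> poly (bound algorithm) (card (verts G)) \<and>
      kd_partition 3 2 G (blocks_output (card (verts G)) s)"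
    if "grid3d G \<and> verts G = {..<card (verts G)}" for G
  proof -
    interpret labelled_grid G "card (verts G)"
      using that by unfold_locales auto
    have "graph_input G ''n'' 0 = card (verts G)"
      by (simp add: graph_input_def Let_def)
    with hoare_algorithm initialised_graph_input show ?thesis
      unfolding hoare_def by fastforce
  qed
  then show ?thesis using grid3d_kd_partition by blast
qed

end
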